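(* Let $(A,\triangleright,\triangleleft)$ be an L-dendriform algebra. Then there exists an L-quadri-algebra structure on $A$ such that $(A,\triangleright,\triangleleft)$ is the associated horizontal L-dendriform algebra if and only if there exists an invertible $\mathcal O$-operator of $(A,\triangleright,\triangleleft)$ (that is, an invertible $\mathcal O$-operator $T:V\to A$ associated to some bimodule $(l_\triangleright,r_\triangleright,l_\triangleleft,r_\triangleleft,V)$ of $(A,\triangleright,\triangleleft)$).
   Context: All algebras are finite-dimensional over a field of characteristic zero. An L-dendriform algebra $(A,\triangleright,\triangleleft)$ is a vector space $A$ with two bilinear products such that for all $x,y,z\in A$: $x\triangleright(y\triangleright z)-(x\bullet y)\triangleright z=y\triangleright(x\triangleright z)-(y\bullet x)\triangleright z$ and $x\triangleright(y\triangleleft z)-(x\triangleright y)\triangleleft z=y\triangleleft(x\bullet z)-(y\triangleleft x)\triangleleft z$, where $x\bullet y=x\triangleright y+x\triangleleft y$. Put also $x\circ y=x\triangleright y-y\triangleleft x$ and $[x,y]=x\bullet y-y\bullet x$. A bimodule of $(A,\triangleright,\triangleleft)$ is a tuple $(l_\triangleright,r_\triangleright,l_\triangleleft,r_\triangleleft,V)$, with $V$ a vector space and four linear maps $A\to gl(V)$, such that for all $x,y\in A$: $[l_\triangleright(x),l_\triangleright(y)]=l_\triangleright([x,y])$; $[l_\triangleright(x),l_\triangleleft(y)]=l_\triangleleft(x\circ y)+l_\triangleleft(y)l_\triangleleft(x)$; $r_\triangleright(x\triangleright y)=r_\triangleright(y)r_\triangleright(x)+r_\triangleright(y)r_\triangleleft(x)+[l_\triangleright(x),r_\triangleright(y)]-r_\triangleright(y)l_\triangleleft(x)$;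 $r_\triangleright(x\triangleleft y)=r_\triangleleft(y)r_\triangleright(x)+l_\triangleleft(x)r_\triangleright(y)+[l_\triangleleft(x),r_\triangleleft(y)]$; $[l_\triangleright(x),r_\triangleleft(y)]=r_\triangleleft(x\bullet y)-r_\triangleleft(y)r_\triangleleft(x)$. An $\mathcal O$-operator associated to this bimodule is a linear map $T:V\to A$ with $T(u)\triangleright T(v)=T[l_\triangleright(T(u))v+r_\triangleright(T(v))u]$ and $T(u)\triangleleft T(v)=T[l_\triangleleft(T(u))v+r_\triangleleft(T(v))u]$ for all $u,v\in V$. An L-quadri-algebra $(A,\searrow,\nearrow,\nwarrow,\swarrow)$ is a vector space with four bilinear products such that for all $x,y,z\in A$: $x\searrow(y\searrow z)-(x\ast y)\searrow z=y\searrow(x\searrow z)-(y\ast x)\searrow z$; $x\searrow(y\nearrow z)-(x\vee y)\nearrow z=y\nearrow(x\succ z)-(y\wedge x)\nearrow z$; $x\searrow(y\nwarrow z)-(x\searrow y)\nwarrow z=y\nwarrow(x\ast z)-(y\nwarrow x)\nwarrow z$; $x\nearrow(y\prec z)-(x\nearrow y)\nwarrow z=y\swarrow(x\wedge z)-(y\swarrow x)\nwarrow z$; $x\searrow(y\swarrow z)-(x\succ y)\swarrow z=y\swarrow(x\vee z)-(y\prec x)\swarrow z$; where $x\succ y=x\searrow y+x\nearrow y$, $x\prec y=x\nwarrow y+x\swarrow y$, $x\vee y=x\searrow y+x\swarrow y$, $x\wedge y=x\nearrow y+x\nwarrow y$, $x\ast y=x\searrow y+x\nearrow y+x\nwarrow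 y+x\swarrow y$. Its associated horizontal L-dendriform algebra has products $x\triangleright y=x\searrow y-y\nwarrow x$, $x\triangleleft y=x\nearrow y-y\swarrow x$. *)

theory Defs
  imports Complex_Main
begin

text \<open>Vector spaces are whole types with an explicit scalar multiplication, as in
  \<^locale>\<open>vector_space\<close>.\<close>

definition bilinear_map ::
  "('k::field \<Rightarrow> 'a::ab_group_add \<Rightarrow> 'a) \<Rightarrow> ('k \<Rightarrow> 'b::ab_group_add \<Rightarrow> 'b) \<Rightarrow>
   ('k \<Rightarrow> 'c::ab_group_add \<Rightarrow> 'c) \<Rightarrow> ('a \<Rightarrow> 'b \<Rightarrow> 'c) \<Rightarrow> bool" where
  "bilinear_map s1 s2 s3 f \<longleftrightarrow>
     (\<forall>x. Vector_Spaces.linear s2 s3 (f x)) \<and>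
     (\<forall>y. Vector_Spaces.linear s1 s3 (\<lambda>x. f x y))"

definition commutator :: "('v \<Rightarrow> 'v) \<Rightarrow> ('v \<Rightarrow> 'v) \<Rightarrow> 'v \<Rightarrow> 'v::ab_group_add" where
  "commutator f g v = f (g v) - g (f v)"

text \<open>\<open>R\<close> and \<open>L\<close> stand for the products \<open>\<triangleright>\<close> and \<open>\<triangleleft>\<close> of an L-dendriform algebra;
  \<open>bullet\<close>, \<open>circ\<close> and \<open>bracket\<close> are the derived products
  \<open>x \<bullet> y\<close>, \<open>x \<circ> y\<close> and \<open>[x, y]\<close>.\<close>

definition bullet :: "('a \<Rightarrow> 'a \<Rightarrow> 'a) \<Rightarrow> ('a \<Rightarrow> 'a \<Rightarrow> 'a) \<Rightarrow> 'a \<Rightarrow> 'a \<Rightarrow> 'a::ab_group_add" where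
  "bullet R L x y = R x y + L x y"

definition circ :: "('a \<Rightarrow> 'a \<Rightarrow> 'a) \<Rightarrow> ('a \<Rightarrow> 'a \<Rightarrow> 'a) \<Rightarrow> 'a \<Rightarrow> 'a \<Rightarrow> 'a::ab_group_add" where
  "circ R L x y = R x y - L y x"

definition bracket :: "('a \<Rightarrow> 'a \<Rightarrow> 'a) \<Rightarrow> ('a \<Rightarrow> 'a \<Rightarrow> 'a) \<Rightarrow> 'a \<Rightarrow> 'a \<Rightarrow> 'a::ab_group_add" where
  "bracket R L x y = bullet R L x y - bullet R L y x"

locale L_dendriform_algebra = vector_space scale
  for scale :: "'k::field \<Rightarrow> 'a::ab_group_add \<Rightarrow> 'a" +
  fixes R L :: "'a \<Rightarrow> 'a \<Rightarrow> 'a"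
  assumes bilinear_R: "bilinear_map scale scale scale R"
    and bilinear_L: "bilinear_map scale scale scale L"
    and dendriform_R:
      "R x (R y z) - R (bullet R L x y) z = R y (R x z) - R (bullet R L y x) z"
    and dendriform_L:
      "R x (L y z) - L (R x y) z = L y (bullet R L x z) - L (L y x) z"

text \<open>\<open>lR\<close>, \<open>rR\<close>, \<open>lL\<close>, \<open>rL\<close> are the actions \<open>l\<^sub>\<triangleright>\<close>, \<open>r\<^sub>\<triangleright>\<close>, \<open>l\<^sub>\<triangleleft>\<close>, \<open>r\<^sub>\<triangleleft>\<close>.  A linear map
  \<open>A \<rightarrow> gl(V)\<close> is the same as a bilinear map \<open>A \<times> V \<rightarrow> V\<close>; the identities between
  endomorphisms of \<open>V\<close> are stated pointwise.\<close>

locale L_dendriform_bimodule =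
  A: L_dendriform_algebra scale R L + V: vector_space scaleV
  for scale :: "'k::field \<Rightarrow> 'a::ab_group_add \<Rightarrow> 'a"
    and R L :: "'a \<Rightarrow> 'a \<Rightarrow> 'a"
    and scaleV :: "'k \<Rightarrow> 'v::ab_group_add \<Rightarrow> 'v" +
  fixes lR rR lL rL :: "'a \<Rightarrow> 'v \<Rightarrow> 'v"
  assumes bilinear_lR: "bilinear_map scale scaleV scaleV lR"
    and bilinear_rR: "bilinear_map scale scaleV scaleV rR"
    and bilinear_lL: "bilinear_map scale scaleV scaleV lL"
    and bilinear_rL: "bilinear_map scale scaleV scaleV rL"
    and bimodule1: "commutator (lR x) (lR y) v = lR (bracket R L x y) v"
    and bimodule2: "commutator (lR x) (lL y) v = lL (circ R L x y) v + lL y (lL x v)"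
    and bimodule3: "rR (R x y) v =
        rR y (rR x v) + rR y (rL x v) + commutator (lR x) (rR y) v - rR y (lL x v)"
    and bimodule4: "rR (L x y) v =
        rL y (rR x v) + lL x (rR y v) + commutator (lL x) (rL y) v"
    and bimodule5: "commutator (lR x) (rL y) v = rL (bullet R L x y) v - rL y (rL x v)"

locale O_operator =
  L_dendriform_bimodule scale R L scaleV lR rR lL rL
  for scale :: "'k::field \<Rightarrow> 'a::ab_group_add \<Rightarrow> 'a"
    and R L :: "'a \<Rightarrow> 'a \<Rightarrow> 'a"
    and scaleV :: "'k \<Rightarrow> 'v::ab_group_add \<Rightarrow> 'v"
    and lR rR lL rL :: "'a \<Rightarrow> 'v \<Rightarrow> 'v" +
  fixes T :: "'v \<Rightarrow> 'a"
  assumes linear_T: "Vector_Spaces.linear scaleV scale T"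
    and O_operator_R: "R (T u) (T v) = T (lR (T u) v + rR (T v) u)"
    and O_operator_L: "L (T u) (T v) = T (lL (T u) v + rL (T v) u)"

text \<open>\<open>se\<close>, \<open>ne\<close>, \<open>nw\<close>, \<open>sw\<close> are the products \<open>\<searrow>\<close>, \<open>\<nearrow>\<close>, \<open>\<nwarrow>\<close>, \<open>\<swarrow>\<close>, and the sums
  \<open>\<succ>\<close>, \<open>\<prec>\<close>, \<open>\<or>\<close>, \<open>\<and>\<close>, \<open>*\<close> of them are the constants below.\<close>

definition quadri_succ ::
  "('a \<Rightarrow> 'a \<Rightarrow> 'a) \<Rightarrow> ('a \<Rightarrow> 'a \<Rightarrow> 'a) \<Rightarrow> 'a \<Rightarrow> 'a \<Rightarrow> 'a::ab_group_add" where
  "quadri_succ se ne x y = se x y + ne x y"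
definition quadri_prec ::
  "('a \<Rightarrow> 'a \<Rightarrow> 'a) \<Rightarrow> ('a \<Rightarrow> 'a \<Rightarrow> 'a) \<Rightarrow> 'a \<Rightarrow> 'a \<Rightarrow> 'a::ab_group_add" where
  "quadri_prec nw sw x y = nw x y + sw x y"
definition quadri_vee ::
  "('a \<Rightarrow> 'a \<Rightarrow> 'a) \<Rightarrow> ('a \<Rightarrow> 'a \<Rightarrow> 'a) \<Rightarrow> 'a \<Rightarrow> 'a \<Rightarrow> 'a::ab_group_add" where
  "quadri_vee se sw x y = se x y + sw x y"
definition quadri_wedge ::
  "('a \<Rightarrow> 'a \<Rightarrow> 'a) \<Rightarrow> ('a \<Rightarrow> 'a \<Rightarrow> 'a) \<Rightarrow> 'a \<Rightarrow> 'a \<Rightarrow> 'a::ab_group_add" where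
  "quadri_wedge ne nw x y = ne x y + nw x y"
definition quadri_ast ::
  "('a \<Rightarrow> 'a \<Rightarrow> 'a) \<Rightarrow> ('a \<Rightarrow> 'a \<Rightarrow> 'a) \<Rightarrow> ('a \<Rightarrow> 'a \<Rightarrow> 'a) \<Rightarrow>
   ('a \<Rightarrow> 'a \<Rightarrow> 'a) \<Rightarrow> 'a \<Rightarrow> 'a \<Rightarrow> 'a::ab_group_add" where
  "quadri_ast se ne nw sw x y = se x y + ne x y + nw x y + sw x y"

locale L_quadri_algebra = vector_space scale
  for scale :: "'k::field \<Rightarrow> 'a::ab_group_add \<Rightarrow> 'a" +
  fixes se ne nw sw :: "'a \<Rightarrow> 'a \<Rightarrow> 'a"
  assumes bilinear_se: "bilinear_map scale scale scale se"
    and bilinear_ne: "bilinear_map scale scale scale ne"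
    and bilinear_nw: "bilinear_map scale scale scale nw"
    and bilinear_sw: "bilinear_map scale scale scale sw"
    and quadri1: "se x (se y z) - se (quadri_ast se ne nw sw x y) z =
        se y (se x z) - se (quadri_ast se ne nw sw y x) z"
    and quadri2: "se x (ne y z) - ne (quadri_vee se sw x y) z =
        ne y (quadri_succ se ne x z) - ne (quadri_wedge ne nw y x) z"
    and quadri3: "se x (nw y z) - nw (se x y) z =
        nw y (quadri_ast se ne nw sw x z) - nw (nw y x) z"
    and quadri4: "ne x (quadri_prec nw sw y z) - nw (ne x y) z =
        sw y (quadri_wedge ne nw x z) - nw (sw y x) z"
    and quadri5: "se x (sw y z) - sw (quadri_succ se ne x y) z =
        sw y (quadri_vee se sw x z) - sw (quadri_prec nw sw y x) z"

text \<open>The two products of the associated horizontal L-dendriform algebra.\<close>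

definition horizontal_R ::
  "('a \<Rightarrow> 'a \<Rightarrow> 'a) \<Rightarrow> ('a \<Rightarrow> 'a \<Rightarrow> 'a) \<Rightarrow> 'a \<Rightarrow> 'a \<Rightarrow> 'a::ab_group_add" where
  "horizontal_R se nw x y = se x y - nw y x"

definition horizontal_L ::
  "('a \<Rightarrow> 'a \<Rightarrow> 'a) \<Rightarrow> ('a \<Rightarrow> 'a \<Rightarrow> 'a) \<Rightarrow> 'a \<Rightarrow> 'a \<Rightarrow> 'a::ab_group_add" where
  "horizontal_L ne sw x y = ne x y - sw y x"

text \<open>\<open>(A, R, L)\<close> is the horizontal L-dendriform algebra of some L-quadri-algebra structure
  on the vector space \<open>A\<close>.\<close>

definition has_L_quadri_structure ::
  "('k::field \<Rightarrow> 'a::ab_group_add \<Rightarrow> 'a) \<Rightarrow> ('a \<Rightarrow> 'a \<Rightarrow> 'a) \<Rightarrow> ('a \<Rightarrow> 'a \<Rightarrow> 'a) \<Rightarrow> bool" where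
  "has_L_quadri_structure scale R L \<longleftrightarrow>
     (\<exists>se ne nw sw. L_quadri_algebra scale se ne nw sw \<and>
        R = horizontal_R se nw \<and> L = horizontal_L ne sw)"

text \<open>Since types cannot be quantified existentially, the type \<open>'v\<close> of the bimodule \<open>V\<close> is an
  explicit argument.  Every \<open>V\<close> with an invertible operator \<open>V \<rightarrow> A\<close> is isomorphic to \<open>A\<close>, so
  existence for some \<open>V\<close> whatsoever amounts to existence for some \<open>V\<close> on the type of \<open>A\<close>; the
  theorem claims this version of existence, and that an operator on a \<open>V\<close> of any other type
  also suffices.\<close>

definition has_invertible_O_operator ::
  "'v::ab_group_add itself \<Rightarrow> ('k::field \<Rightarrow> 'a::ab_group_add \<Rightarrow> 'a) \<Rightarrow>
   ('a \<Rightarrow> 'a \<Rightarrow> 'a) \<Rightarrow> ('a \<Rightarrow> 'a \<Rightarrow> 'a) \<Rightarrow> bool" where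
  "has_invertible_O_operator (_ :: 'v itself) scale R L \<longleftrightarrow>
     (\<exists>(scaleV :: 'k \<Rightarrow> 'v \<Rightarrow> 'v) lR rR lL rL T.
        O_operator scale R L scaleV lR rR lL rL T \<and> bij T)"

end

theory Submission
  imports Defs
begin

text \<open>Over the identity map, the \<open>\<O>\<close>-operator identities say exactly that \<open>R\<close> and \<open>L\<close> are the
  horizontal products of \<open>se = l\<^sub>\<triangleright>\<close>, \<open>nw = - r\<^sub>\<triangleright>\<close>, \<open>ne = l\<^sub>\<triangleleft>\<close>, \<open>sw = - r\<^sub>\<triangleleft>\<close>, and the five bimodule
  identities then become the five L-quadri-algebra identities, one by one.  An invertible
  \<open>T : V \<rightarrow> A\<close> is reduced to the identity map by conjugating the actions with \<open>T\<close>.\<close>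

lemma linear_imp_module_hom: "Vector_Spaces.linear s1 s2 f \<Longrightarrow> module_hom s1 s2 f"
  by (simp add: linear_iff_module_hom)

text \<open>Serve as rewrite rules that expand products of sums into sums of nested products, so
  that comparing algebra identities becomes arithmetic in an abelian group.\<close>

lemma
  assumes "bilinear_map s1 s2 s3 f"
  shows bilinear_map_add_left: "f (x + y) z = f x z + f y z"
    and bilinear_map_diff_left: "f (x - y) z = f x z - f y z"
    and bilinear_map_minus_left: "f (- x) z = - f x z"
    and bilinear_map_add_right: "f x (y + z) = f x y + f x z"
    and bilinear_map_diff_right: "f x (y - z) = f x y - f x z"
    and bilinear_map_minus_right: "f x (- y) = - f x y"
proof -
  interpret left: module_hom s1 s3 "\<lambda>x. f x z"
    using assms by (simp add: bilinear_map_def linear_iff_module_hom)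
  interpret right: module_hom s2 s3 "f x"
    using assms by (simp add: bilinear_map_def linear_iff_module_hom)
  show "f (x + y) z = f x z + f y z" "f (x - y) z = f x z - f y z" "f (- x) z = - f x z"
    by (fact left.add left.diff left.neg)+
  show "f x (y + z) = f x y + f x z" "f x (y - z) = f x y - f x z" "f x (- y) = - f x y"
    by (fact right.add right.diff right.neg)+
qed

lemma bilinear_map_uminus:
  assumes "bilinear_map s1 s2 s3 f"
  shows "bilinear_map s1 s2 s3 (\<lambda>x y. - f x y)"
  using assms unfolding bilinear_map_def linear_iff_module_hom
  by (auto simp: module_hom_iff module.scale_minus_right)

text \<open>Transports an action to another space: the acting argument stays, while the acted-on
  space changes along \<open>T\<close> and \<open>S\<close>. The case of interest is
  \<open>S = inv T\<close>.\<close>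

lemma bilinear_map_conjugate:
  assumes "bilinear_map s1 s2 s2 f"
    and "Vector_Spaces.linear s2 s3 T" and "Vector_Spaces.linear s3 s2 S"
  shows "bilinear_map s1 s3 s3 (\<lambda>x y. T (f x (S y)))"
proof -
  note compose = Vector_Spaces.linear_compose[unfolded comp_def]
  have f: "Vector_Spaces.linear s2 s2 (f x)" "Vector_Spaces.linear s1 s2 (\<lambda>x. f x y)" for x y
    using assms(1) by (simp_all add: bilinear_map_def)
  show ?thesis
    unfolding bilinear_map_def
    using compose[OF compose[OF assms(3) f(1)] assms(2)] compose[OF f(2) assms(2)] by blast
qed

lemma linear_inv_bij:
  assumes "Vector_Spaces.linear s1 s2 T" and "bij T"
  shows "Vector_Spaces.linear s2 s1 (inv T)"
  using assms by (simp add: linear_iff_module_hom bij_module_hom_imp_inv_module_hom)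

text \<open>In a composite of twisted actions, \<open>inv T\<close> cancels the \<open>T\<close> of
  the inner action, so twisting respects composition as well as sums, and every bimodule identity
  carries over from \<open>V\<close> to \<open>A\<close>.\<close>

lemma (in O_operator) O_operator_conjugate_id:
  assumes "bij T"
  defines "twist \<equiv> (\<lambda>f x y. T (f x (inv T y)))"
  shows "O_operator scale R L scale (twist lR) (twist rR) (twist lL) (twist rL) id"
proof -
  have inv: "inv T (T v) = v" "T (inv T x) = x" for v x
    using assms(1) by (simp_all add: bij_is_inj bij_is_surj surj_f_inv_f)
  \<comment> \<open>Oriented to collect sums of \<open>T\<close>-images under a single
    \<open>T\<close>: each goal becomes \<open>T\<close> applied to both sides of an original
    identity taken at \<open>inv T v\<close>.\<close>
  note T_simps = module_hom.add[OF linear_imp_module_hom[OF linear_T], symmetric]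
    module_hom.diff[OF linear_imp_module_hom[OF linear_T], symmetric]
  note bil = bilinear_map_conjugate[OF _ linear_T linear_inv_bij[OF linear_T assms(1)]]
  show ?thesis
  proof unfold_locales
    show "bilinear_map scale scale scale (twist lR)" "bilinear_map scale scale scale (twist rR)"
      "bilinear_map scale scale scale (twist lL)" "bilinear_map scale scale scale (twist rL)"
      unfolding twist_def using bil bilinear_lR bilinear_rR bilinear_lL bilinear_rL by blast+
  next
    fix x y v
    show "commutator (twist lR x) (twist lR y) v = twist lR (bracket R L x y) v"
      using bimodule1[of x y "inv T v"] by (simp add: twist_def commutator_def inv T_simps)
    show "commutator (twist lR x) (twist lL y) v
        = twist lL (circ R L x y) v + twist lL y (twist lL x v)"
      using bimodule2[of x y "inv T v"] by (simp add: twist_def commutator_def inv T_simps)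
    show "twist rR (R x y) v = twist rR y (twist rR x v) + twist rR y (twist rL x v)
        + commutator (twist lR x) (twist rR y) v - twist rR y (twist lL x v)"
      using bimodule3[of x y "inv T v"] by (simp add: twist_def commutator_def inv T_simps)
    show "twist rR (L x y) v = twist rL y (twist rR x v) + twist lL x (twist rR y v)
        + commutator (twist lL x) (twist rL y) v"
      using bimodule4[of x y "inv T v"] by (simp add: twist_def commutator_def inv T_simps)
    show "commutator (twist lR x) (twist rL y) v
        = twist rL (bullet R L x y) v - twist rL y (twist rL x v)"
      using bimodule5[of x y "inv T v"] by (simp add: twist_def commutator_def inv T_simps)
  next
    fix u v
    show "R (id u) (id v) = id (twist lR (id u) v + twist rR (id v) u)"
      \<comment> \<open>At these preimages the left side of the identity for \<open>T\<close> is
        \<open>R u v\<close> itself.\<close>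
      using O_operator_R[of "inv T u" "inv T v"] by (simp add: twist_def inv T_simps)
    show "L (id u) (id v) = id (twist lL (id u) v + twist rL (id v) u)"
      using O_operator_L[of "inv T u" "inv T v"] by (simp add: twist_def inv T_simps)
  qed simp_all
qed

lemma L_quadri_algebra_if_O_operator_id:
  assumes "O_operator scale R L scale lR rR lL rL id"
  defines "nw \<equiv> (\<lambda>x y. - rR x y)" and "sw \<equiv> (\<lambda>x y. - rL x y)"
  shows "L_quadri_algebra scale lR lL nw sw"
    and "R = horizontal_R lR nw" and "L = horizontal_L lL sw"
proof -
  interpret O_operator scale R L scale lR rR lL rL id by fact
  note bil = bilinear_lR bilinear_rR bilinear_lL bilinear_rL
  note bil_simps = bil[THEN bilinear_map_add_left] bil[THEN bilinear_map_diff_left]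
    bil[THEN bilinear_map_minus_left] bil[THEN bilinear_map_add_right]
    bil[THEN bilinear_map_diff_right] bil[THEN bilinear_map_minus_right]
  \<comment> \<open>With \<open>id\<close> as operator, its two identities are explicit formulas for
    \<open>R\<close> and \<open>L\<close>; rewriting with them leaves only the four actions.\<close>
  have R: "R x y = lR x y + rR y x" and L: "L x y = lL x y + rL y x" for x y
    using O_operator_R[of x y] O_operator_L[of x y] by simp_all
  show "R = horizontal_R lR nw" "L = horizontal_L lL sw"
    by (simp_all add: fun_eq_iff R L horizontal_R_def horizontal_L_def nw_def sw_def)
  note defs = nw_def sw_def R L commutator_def bracket_def bullet_def circ_def
    quadri_ast_def quadri_vee_def quadri_wedge_def quadri_succ_def quadri_prec_def
  show "L_quadri_algebra scale lR lL nw sw"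
  proof unfold_locales
    show "bilinear_map scale scale scale lR" "bilinear_map scale scale scale lL"
      "bilinear_map scale scale scale nw" "bilinear_map scale scale scale sw"
      unfolding nw_def sw_def using bil bilinear_map_uminus by blast+
  next
    \<comment> \<open>After this substitution \<open>bracket R L x y\<close> is the
      \<open>quadri_ast\<close> of \<open>x y\<close> minus that of \<open>y x\<close>,
      \<open>circ R L x y\<close> is \<open>quadri_vee\<close> of \<open>x y\<close> minus
      \<open>quadri_wedge\<close> of \<open>y x\<close>, and \<open>bullet R L x y\<close> is
      \<open>quadri_succ\<close> of \<open>x y\<close> minus \<open>quadri_prec\<close> of
      \<open>y x\<close>. Each goal is then a rearranged bimodule identity.\<close>
    fix x y z
    show "lR x (lR y z) - lR (quadri_ast lR lL nw sw x y) z
        = lR y (lR x z) - lR (quadri_ast lR lL nw sw y x) z"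
      using bimodule1[of x y z] by (simp add: defs bil_simps algebra_simps)
    show "lR x (lL y z) - lL (quadri_vee lR sw x y) z
        = lL y (quadri_succ lR lL x z) - lL (quadri_wedge lL nw y x) z"
      using bimodule2[of x y z] by (simp add: defs bil_simps algebra_simps)
    show "lR x (nw y z) - nw (lR x y) z
        = nw y (quadri_ast lR lL nw sw x z) - nw (nw y x) z"
      using bimodule3[of x y z] by (simp add: defs bil_simps algebra_simps)
    show "lL x (quadri_prec nw sw y z) - nw (lL x y) z
        = sw y (quadri_wedge lL nw x z) - nw (sw y x) z"
      using bimodule4[of x y z] by (simp add: defs bil_simps algebra_simps)
    show "lR x (sw y z) - sw (quadri_succ lR lL x y) z
        = sw y (quadri_vee lR sw x z) - sw (quadri_prec nw sw y x) z"
      using bimodule5[of x y z] by (simp add: defs bil_simps algebra_simps)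
  qed
qed

text \<open>The algebra acts on itself by its four products; the minus signs match those in the
  horizontal products, and the same expansions are read backwards.\<close>

lemma (in L_quadri_algebra) O_operator_id_if_L_quadri_algebra:
  assumes "L_dendriform_algebra scale R L"
    and "R = horizontal_R se nw" and "L = horizontal_L ne sw"
  shows "O_operator scale R L scale se (\<lambda>x y. - nw x y) ne (\<lambda>x y. - sw x y) id"
proof -
  interpret A: L_dendriform_algebra scale R L by fact
  note bil = bilinear_se bilinear_ne bilinear_nw bilinear_sw
  note bil_simps = bil[THEN bilinear_map_add_left] bil[THEN bilinear_map_diff_left]
    bil[THEN bilinear_map_minus_left] bil[THEN bilinear_map_add_right]
    bil[THEN bilinear_map_diff_right] bil[THEN bilinear_map_minus_right]
  have R: "R x y = se x y - nw y x" and L: "L x y = ne x y - sw y x" for x y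
    by (simp_all add: assms horizontal_R_def horizontal_L_def)
  note defs = R L commutator_def bracket_def bullet_def circ_def
    quadri_ast_def quadri_vee_def quadri_wedge_def quadri_succ_def quadri_prec_def
  show ?thesis
  proof unfold_locales
    show "bilinear_map scale scale scale se" "bilinear_map scale scale scale ne"
      "bilinear_map scale scale scale (\<lambda>x y. - nw x y)"
      "bilinear_map scale scale scale (\<lambda>x y. - sw x y)"
      using bil bilinear_map_uminus by blast+
  next
    fix x y v
    show "commutator (se x) (se y) v = se (bracket R L x y) v"
      using quadri1[of x y v] by (simp add: defs bil_simps algebra_simps)
    show "commutator (se x) (ne y) v = ne (circ R L x y) v + ne y (ne x v)"
      using quadri2[of x y v] by (simp add: defs bil_simps algebra_simps)
    show "- nw (R x y) v = - nw y (- nw x v) + - nw y (- sw x v)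
        + commutator (se x) (\<lambda>v. - nw y v) v - - nw y (ne x v)"
      using quadri3[of x y v] by (simp add: defs bil_simps algebra_simps)
    show "- nw (L x y) v = - sw y (- nw x v) + ne x (- nw y v)
        + commutator (ne x) (\<lambda>v. - sw y v) v"
      using quadri4[of x y v] by (simp add: defs bil_simps algebra_simps)
    show "commutator (se x) (\<lambda>v. - sw y v) v = - sw (bullet R L x y) v - - sw y (- sw x v)"
      using quadri5[of x y v] by (simp add: defs bil_simps algebra_simps)
  \<comment> \<open>What remains is the linearity of \<open>id\<close> and the two operator
    identities, which for \<open>id\<close> are the formulas for \<open>R\<close> and
    \<open>L\<close>.\<close>
  qed (simp_all add: R L)
qed

lemma has_L_quadri_structure_if_has_invertible_O_operator:
  assumes "has_invertible_O_operator TYPE('v::ab_group_add) scale R L"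
  shows "has_L_quadri_structure scale R L"
proof -
  obtain scaleV :: "_ \<Rightarrow> 'v \<Rightarrow> 'v" and lR rR lL rL T
    where "O_operator scale R L scaleV lR rR lL rL T" and "bij T"
    using assms by (auto simp: has_invertible_O_operator_def)
  \<comment> \<open>The twisted actions live on \<open>A\<close>, so they supply the four products
    whatever the type of \<open>V\<close>.\<close>
  from L_quadri_algebra_if_O_operator_id[OF O_operator.O_operator_conjugate_id[OF this]]
  show ?thesis
    unfolding has_L_quadri_structure_def by blast
qed

lemma has_invertible_O_operator_if_has_L_quadri_structure:
  fixes R :: "'a::ab_group_add \<Rightarrow> 'a \<Rightarrow> 'a"
  assumes "L_dendriform_algebra scale R L" and "has_L_quadri_structure scale R L"
  shows "has_invertible_O_operator TYPE('a) scale R L"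
  \<comment> \<open>The witnesses are \<open>V = A\<close> with its own scalar multiplication and
    \<open>T = id\<close>.\<close>
  using assms L_quadri_algebra.O_operator_id_if_L_quadri_algebra bij_id
  unfolding has_L_quadri_structure_def has_invertible_O_operator_def by metis

theorem theorem3p17:
  fixes scale :: "'k::field_char_0 \<Rightarrow> 'a::ab_group_add \<Rightarrow> 'a"
    and Basis :: "'a set"
    and R L :: "'a \<Rightarrow> 'a \<Rightarrow> 'a"
  assumes "finite_dimensional_vector_space scale Basis"
    and "L_dendriform_algebra scale R L"
  shows "(has_L_quadri_structure scale R L \<longleftrightarrow>
            has_invertible_O_operator TYPE('a) scale R L) \<and>
         (has_invertible_O_operator TYPE('v::ab_group_add) scale R L \<longrightarrow>
            has_L_quadri_structure scale R L)"
  \<comment> \<open>The passage from operators to quadri-structures enters at two types: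
    \<open>'a\<close> for the equivalence, \<open>'v\<close> for the second conjunct.\<close>
  using has_invertible_O_operator_if_has_L_quadri_structure[OF assms(2)]
    has_L_quadri_structure_if_has_invertible_O_operator[where 'v = 'a]
    has_L_quadri_structure_if_has_invertible_O_operator[where 'v = 'v]
  by blast

end
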